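(* Let $K$ be a field of characteristic $\ell \geq 0$, and let $\phi \in K(z)$ be bicritical of degree $d \geq 2$ with critical points $\gamma_1, \gamma_2 \in \mathbb{P}^1(\overline{K})$. Assume that $\ell = 0$ or $\ell > d$. If $K(\gamma_1, \gamma_2) \neq K$ then $[K(\gamma_1, \gamma_2) : K] = 2$ and $\gamma_1$ and $\gamma_2$ are Galois-conjugate over $K$.
   Context: $\overline{K}$ is a fixed algebraic closure of $K$. Write $\phi = p/q$ with $p,q\in K[z]$ having no common root in $\overline K$. For $\alpha\in\overline K$ the ramification index $e_\alpha(\phi)$ is the order of vanishing at $z=\alpha$ of $p(z)q(\alpha)-q(z)p(\alpha)$; and $e_\infty(\phi)=e_0(\psi)$ where $\psi(z)=1/\phi(1/z)$. A point $\alpha\in\mathbb{P}^1(\overline K)$ is a critical point of $\phi$ if $e_\alpha(\phi)>1$. The map $\phi$ is bicritical if it has precisely two (distinct) critical points $\gamma_1,\gamma_2$ in $\mathbb{P}^1(\overline K)$. By convention $K(\infty)=K$. *)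

theory Defs
  imports
    "HOL-Computational_Algebra.Computational_Algebra"
    "HOL-Algebra.Algebraic_Closure_Type"
    "HOL-Algebra.Generated_Fields"
    "HOL-Algebra.Embedded_Algebras"
begin

hide_const (open) Polynomials.degree Polynomials.lead_coeff Coset.order Module.smult

section \<open>Rational functions over a field\<close>

text \<open>
  The field \<open>K\<close> is the type \<open>'a\<close>, its algebraic closure is \<open>'a alg_closure\<close> with the embedding
  \<^const>\<open>to_ac\<close>, and \<open>K(z)\<close> is the fraction field \<open>'a poly fract\<close>.
\<close>

abbreviation lift_poly :: "'a::field poly \<Rightarrow> 'a alg_closure poly"
  where "lift_poly \<equiv> map_poly to_ac"

definition is_reduced :: "'a::field poly fract \<Rightarrow> 'a poly \<Rightarrow> 'a poly \<Rightarrow> bool"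
  where "is_reduced \<phi> p q \<longleftrightarrow> q \<noteq> 0 \<and> \<phi> = Fract p q \<and>
    \<not> (\<exists>\<alpha>. poly (lift_poly p) \<alpha> = 0 \<and> poly (lift_poly q) \<alpha> = 0)"

text \<open>
  A reduced representation exists, and it is unique up to a common nonzero constant factor
  (lemmas \<open>reduced_exists\<close> and \<open>reduced_unique\<close>); nothing below depends on the choice.
\<close>

definition num_den :: "'a::field poly fract \<Rightarrow> 'a poly \<times> 'a poly"
  where "num_den \<phi> = (SOME (p, q). is_reduced \<phi> p q)"

abbreviation rat_num :: "'a::field poly fract \<Rightarrow> 'a poly"
  where "rat_num \<phi> \<equiv> fst (num_den \<phi>)"

abbreviation rat_den :: "'a::field poly fract \<Rightarrow> 'a poly"
  where "rat_den \<phi> \<equiv> snd (num_den \<phi>)"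

definition rat_degree :: "'a::field poly fract \<Rightarrow> nat"
  where "rat_degree \<phi> = max (degree (rat_num \<phi>)) (degree (rat_den \<phi>))"

text \<open>\<open>\<psi>(z) = 1 / \<phi>(1/z)\<close>, computed in the field \<open>K(z)\<close>.\<close>

definition poly_at :: "'a::field poly \<Rightarrow> 'a poly fract \<Rightarrow> 'a poly fract"
  where "poly_at p f = poly (map_poly (\<lambda>c. Fract [:c:] 1) p) f"

definition conj_inverse :: "'a::field poly fract \<Rightarrow> 'a poly fract"
  where "conj_inverse \<phi> =
    (let w = Fract 1 [:0, 1:] in 1 / (poly_at (rat_num \<phi>) w / poly_at (rat_den \<phi>) w))"


section \<open>Ramification on the projective line\<close>

datatype 'b proj_line = Pt 'b | Infty

definition ram_index_affine :: "'a::field poly fract \<Rightarrow> 'a alg_closure \<Rightarrow> nat"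
  where "ram_index_affine \<phi> \<alpha> =
    (let p = lift_poly (rat_num \<phi>); q = lift_poly (rat_den \<phi>)
     in order \<alpha> (smult (poly q \<alpha>) p - smult (poly p \<alpha>) q))"

fun ram_index :: "'a::field poly fract \<Rightarrow> 'a alg_closure proj_line \<Rightarrow> nat"
  where
    "ram_index \<phi> (Pt \<alpha>) = ram_index_affine \<phi> \<alpha>"
  | "ram_index \<phi> Infty = ram_index_affine (conj_inverse \<phi>) 0"

definition critical_points :: "'a::field poly fract \<Rightarrow> 'a alg_closure proj_line set"
  where "critical_points \<phi> = {\<gamma>. ram_index \<phi> \<gamma> > 1}"

definition bicritical :: "'a::field poly fract \<Rightarrow> bool"
  where "bicritical \<phi> \<longleftrightarrow> card (critical_points \<phi>) = 2"


section \<open>Fields generated by points, and Galois conjugacy\<close>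

abbreviation closure_ring :: "'a::field alg_closure ring"
  where "closure_ring \<equiv> ring_of_type_algebra"

abbreviation base_field :: "'a::field alg_closure set"
  where "base_field \<equiv> range to_ac"

text \<open>The point at infinity contributes no generator, in accordance with \<open>K(\<infinity>) = K\<close>.\<close>

definition field_gen :: "'a::field alg_closure proj_line set \<Rightarrow> 'a alg_closure set"
  where "field_gen S = generate_field closure_ring (base_field \<union> {\<alpha>. Pt \<alpha> \<in> S})"

definition has_ext_degree :: "'a::field alg_closure set \<Rightarrow> nat \<Rightarrow> bool"
  where "has_ext_degree E n \<longleftrightarrow> ring.dimension closure_ring n base_field E"

definition abs_galois :: "('a::field alg_closure \<Rightarrow> 'a alg_closure) set"
  where "abs_galois = {\<sigma> \<in> ring_iso closure_ring closure_ring. \<forall>c. \<sigma> (to_ac c) = to_ac c}"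

text \<open>\<open>map_proj_line \<sigma>\<close> is the coordinatewise action of \<open>\<sigma>\<close>; it fixes \<^const>\<open>Infty\<close>.\<close>

definition galois_conjugate :: "'a::field alg_closure proj_line \<Rightarrow> 'a alg_closure proj_line \<Rightarrow> bool"
  where "galois_conjugate \<gamma> \<delta> \<longleftrightarrow> (\<exists>\<sigma>\<in>abs_galois. map_proj_line \<sigma> \<gamma> = \<delta>)"


section \<open>Existence and uniqueness of reduced representations\<close>

lemma lift_poly_add: "lift_poly (p + q) = lift_poly p + lift_poly q"
  by (rule poly_eqI) (simp add: coeff_map_poly)

lemma lift_poly_mult: "lift_poly (p * q) = lift_poly p * lift_poly q"
  by (rule poly_eqI) (simp add: coeff_map_poly coeff_mult to_ac_sum)

lemma poly_bezout:
  fixes p q :: "'a::field poly"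
  assumes "q \<noteq> 0"
  obtains g a b where "g \<noteq> 0" "g = a * p + b * q" "g dvd p" "g dvd q"
proof -
  define I where "I = {f. f \<noteq> 0 \<and> (\<exists>a b. f = a * p + b * q)}"
  have "q = 0 * p + 1 * q" by simp
  then have "q \<in> I" unfolding I_def using assms by blast
  then obtain g where g: "g \<in> I" and min: "\<And>f. f \<in> I \<Longrightarrow> degree g \<le> degree f"
    using ex_has_least_nat[of "\<lambda>f. f \<in> I" q degree] by blast
  from g obtain a b where ab: "g \<noteq> 0" "g = a * p + b * q" by (auto simp: I_def)
  have "g dvd c * p + d * q" for c d
  proof (rule ccontr)
    let ?f = "c * p + d * q"
    assume nd: "\<not> g dvd ?f"
    then have nz: "?f mod g \<noteq> 0" by (simp add: dvd_eq_mod_eq_0)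
    have "?f mod g = ?f - ?f div g * g" by (simp add: minus_div_mult_eq_mod)
    also have "\<dots> = (c - ?f div g * a) * p + (d - ?f div g * b) * q"
    proof -
      have "?f div g * g = ?f div g * (a * p + b * q)" by (simp only: ab(2)[symmetric])
      then show ?thesis by (simp only:) (simp add: algebra_simps)
    qed
    finally have "?f mod g \<in> I" using nz unfolding I_def by blast
    then have "degree g \<le> degree (?f mod g)" by (rule min)
    moreover have "degree (?f mod g) < degree g \<or> ?f mod g = 0"
      using degree_mod_less[OF ab(1), of ?f] by blast
    ultimately show False using nz by simp
  qed
  from this[of 1 0] this[of 0 1] show ?thesis using that ab by simp
qed

lemma reduced_exists: "\<exists>p q. is_reduced \<phi> p q"
proof (cases \<phi>)
  case (Fract p q)
  then obtain g a b where g: "g \<noteq> 0" "g = a * p + b * q" "g dvd p" "g dvd q"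
    using poly_bezout by blast
  from g(3,4) obtain p' q' where pq: "p = g * p'" "q = g * q'" by (meson dvdE)
  have "g * (a * p' + b * q') = g * 1"
    using g(2) unfolding pq by (simp add: distrib_left mult.left_commute)
  then have one: "a * p' + b * q' = 1"
    using g(1) mult_cancel_left[of g "a * p' + b * q'" 1] by blast
  have "\<not> (\<exists>\<alpha>. poly (lift_poly p') \<alpha> = 0 \<and> poly (lift_poly q') \<alpha> = 0)"
  proof
    assume "\<exists>\<alpha>. poly (lift_poly p') \<alpha> = 0 \<and> poly (lift_poly q') \<alpha> = 0"
    then obtain \<alpha> where "poly (lift_poly p') \<alpha> = 0" "poly (lift_poly q') \<alpha> = 0" by blast
    then have "poly (lift_poly (a * p' + b * q')) \<alpha> = 0"
      by (simp add: lift_poly_add lift_poly_mult)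
    then show False by (simp add: one)
  qed
  moreover have "\<phi> = Fract p' q'"
    using Fract g(1) by (simp add: pq mult_fract_cancel)
  moreover have "q' \<noteq> 0" using Fract pq by auto
  ultimately show ?thesis unfolding is_reduced_def by blast
qed

lemma reduced_unique:
  assumes "is_reduced \<phi> p q" "is_reduced \<phi> p' q'"
  shows "\<exists>c. c \<noteq> 0 \<and> p' = smult c p \<and> q' = smult c q"
proof -
  from assms have nz: "q \<noteq> 0" "q' \<noteq> 0" and eq: "p * q' = p' * q"
    by (auto simp: is_reduced_def eq_fract)
  obtain g a b where g: "g \<noteq> 0" "g = a * p + b * q" "g dvd p" "g dvd q"
    using poly_bezout nz(1) by blast
  have const: "degree f = 0" if "f dvd r" "f dvd s" "is_reduced \<phi> r s" for f r s
  proof (rule ccontr)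
    assume "degree f \<noteq> 0"
    then have "degree (lift_poly f) > 0" by (simp add: degree_map_poly)
    then obtain \<alpha> where "poly (lift_poly f) \<alpha> = 0"
      using alg_closed_imp_poly_has_root by blast
    with that show False by (auto simp: is_reduced_def dvd_def lift_poly_mult)
  qed
  from const[OF g(3,4) assms(1)] obtain k where k: "g = [:k:]" by (auto elim: degree_eq_zeroE)
  with g(1) have "k \<noteq> 0" by simp
  define u where "u = a * p' + b * q'"
  have q': "smult k q' = q * u"
  proof -
    have "smult k q' = g * q'" by (simp add: k)
    also have "\<dots> = a * (p * q') + b * q * q'" by (simp add: g(2) algebra_simps)
    also have "\<dots> = q * u" by (simp add: eq u_def algebra_simps)
    finally show ?thesis .
  qed
  have p': "smult k p' = p * u"
  proof -
    have "smult k p' = g * p'" by (simp add: k)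
    also have "\<dots> = a * p * p' + b * (p' * q)" by (simp add: g(2) algebra_simps)
    also have "\<dots> = p * u" by (simp add: eq[symmetric] u_def algebra_simps)
    finally show ?thesis .
  qed
  have "u dvd smult k p'" "u dvd smult k q'" by (simp_all add: p' q')
  with \<open>k \<noteq> 0\<close> have "u dvd p'" "u dvd q'" by (simp_all add: dvd_smult_iff)
  from const[OF this assms(2)] obtain l where l: "u = [:l:]" by (auto elim: degree_eq_zeroE)
  have "q' = smult (l / k) q" "p' = smult (l / k) p"
    using arg_cong[OF q', of "smult (1 / k)"] arg_cong[OF p', of "smult (1 / k)"] \<open>k \<noteq> 0\<close>
    by (simp_all add: l)
  moreover from this nz have "l / k \<noteq> 0" by auto
  ultimately show ?thesis by blast
qed

lemma num_den_reduced: "is_reduced \<phi> (rat_num \<phi>) (rat_den \<phi>)"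
proof -
  obtain p q where "is_reduced \<phi> p q" using reduced_exists by blast
  then have "\<exists>x. case x of (p, q) \<Rightarrow> is_reduced \<phi> p q" by auto
  then have "case num_den \<phi> of (p, q) \<Rightarrow> is_reduced \<phi> p q"
    unfolding num_den_def by (rule someI_ex)
  then show ?thesis by (simp add: case_prod_beta)
qed

end

theory Submission
  imports Defs
begin

text \<open>
  Write \<open>\<phi> = p / q\<close> in lowest terms. The finite critical points of \<open>\<phi>\<close> are the roots of the Wronskian
  \<open>w = p' q - p q'\<close>, a polynomial over \<open>K\<close>. If \<open>\<phi>\<close> has ramification index \<open>e\<close> at a finite point
  \<open>\<alpha>\<close>, then \<open>w\<close> vanishes there to order exactly \<open>e - 1\<close>, because \<open>e \<le> d\<close> is invertible in \<open>K\<close>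
  (\<open>ram_index_wronskian\<close>). So \<open>w\<close> is a nonzero polynomial over \<open>K\<close> with at most two distinct roots,
  each of multiplicity below the characteristic if that is positive.

  If the critical points generate a proper extension, then one of them is a finite point \<open>\<alpha>\<close>
  outside \<open>K\<close>. The irreducible factor \<open>f\<close> of \<open>w\<close> that vanishes at \<open>\<alpha>\<close> is separable, since an
  inseparable one would have \<open>\<alpha>\<close> as a root of multiplicity divisible by the characteristic. It is not
  linear, and all its roots are roots of \<open>w\<close>; hence \<open>w\<close> has a second root \<open>\<beta>\<close>, and \<open>f\<close> is a
  constant times \<open>(z - \<alpha>) (z - \<beta>)\<close> (\<open>quadratic_factor\<close>). In particular, infinity cannot be the
  other critical point. Now \<open>\<alpha> + \<beta>\<close> and
  \<open>\<alpha> \<beta>\<close> lie in \<open>K\<close>, so \<open>K(\<alpha>, \<beta>)\<close> has the basis \<open>1, \<alpha>\<close> over \<open>K\<close> (\<open>field_gen_quadratic\<close>,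
  \<open>quadratic_ext_degree\<close>).

  Finally, \<open>\<alpha>\<close> and \<open>\<beta>\<close> are roots of the same irreducible polynomial, and the automorphisms of the
  algebraic closure over \<open>K\<close> permute such roots transitively (\<open>galois_transitive_on_roots\<close>). This is
  proved by extending the isomorphism from \<open>K(\<alpha>)\<close> to \<open>K(\<beta>)\<close> with Zorn's lemma.
\<close>

section \<open>Polynomials over the base field evaluated in the closure\<close>

lemma lift_poly_diff: "lift_poly (p - q) = lift_poly p - lift_poly q"
  by (rule poly_eqI) (simp add: coeff_map_poly)

lemma lift_poly_pderiv: "lift_poly (pderiv p) = pderiv (lift_poly p)"
  by (rule poly_eqI) (simp add: coeff_map_poly coeff_pderiv)

lemma lift_poly_dvd: "f dvd g \<Longrightarrow> lift_poly f dvd lift_poly g"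
  by (auto simp: dvd_def lift_poly_mult)

lemma lift_poly_eq_0_iff: "lift_poly p = 0 \<longleftrightarrow> p = 0"
  by (auto simp: poly_eq_iff coeff_map_poly)

lemma degree_neq_0_of_root:
  fixes p :: "'b::comm_ring_1 poly"
  assumes "p \<noteq> 0" "poly p x = 0"
  shows "degree p \<noteq> 0"
proof
  assume "degree p = 0"
  then obtain c where "p = [:c:]" by (rule degree_eq_zeroE)
  with assms show False by simp
qed

lemma poly_lift_root_dvd:
  assumes "poly (lift_poly f) \<alpha> = 0" "f dvd g"
  shows "poly (lift_poly g) \<alpha> = 0"
  using assms by (auto simp: dvd_def lift_poly_mult)

lemma not_unit_of_root:
  assumes "poly (lift_poly f) \<alpha> = 0"
  shows "\<not> f dvd 1"
proof
  assume "f dvd 1"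
  with assms have "poly (lift_poly 1) \<alpha> = 0" by (rule poly_lift_root_dvd)
  then show False by simp
qed

lemma irreducible_lift_nonzero: "irreducible f \<Longrightarrow> lift_poly f \<noteq> 0"
  using not_irreducible_zero lift_poly_eq_0_iff by metis

text \<open>
  A common root survives in the Bezout combination \<open>d\<close> of \<open>f\<close> and \<open>g\<close>, so \<open>d\<close> is a nonunit divisor
  of the irreducible \<open>f\<close>, and therefore associated to it.
\<close>

lemma irreducible_dvd_iff_root:
  assumes "irreducible f" "poly (lift_poly f) \<alpha> = 0"
  shows "poly (lift_poly g) \<alpha> = 0 \<longleftrightarrow> f dvd g"
proof
  assume g: "poly (lift_poly g) \<alpha> = 0"
  have "f \<noteq> 0" using assms(1) not_irreducible_zero by metis
  then obtain d a b where d: "d = a * g + b * f" "d dvd g" "d dvd f"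
    by (rule poly_bezout)
  have root: "poly (lift_poly d) \<alpha> = 0"
    using g assms(2) by (simp add: d(1) lift_poly_add lift_poly_mult)
  have "\<not> d dvd 1" using root by (rule not_unit_of_root)
  moreover obtain k where k: "f = d * k" using d(3) by (rule dvdE)
  ultimately have "k dvd 1" using irreducibleD[OF assms(1) k] by simp
  then have "f dvd d" unfolding k by (simp add: mult_unit_dvd_iff)
  then show "f dvd g" using d(2) by (rule dvd_trans)
next
  assume "f dvd g"
  with assms(2) show "poly (lift_poly g) \<alpha> = 0" by (rule poly_lift_root_dvd)
qed

text \<open>
  A nonzero polynomial of least degree that vanishes at \<open>\<alpha>\<close> is irreducible: one of the two factors
  in any factorization vanishes at \<open>\<alpha>\<close> and thus already has full degree.
\<close>

lemma irreducible_poly_exists: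
  fixes \<alpha> :: "'a::field alg_closure"
  obtains f where "irreducible f" "poly (lift_poly f) \<alpha> = 0"
proof -
  obtain p where p: "p \<noteq> 0 \<and> poly (lift_poly p) \<alpha> = 0"
    using alg_closure_algebraic[of \<alpha>] by blast
  then obtain f where f: "f \<noteq> 0" "poly (lift_poly f) \<alpha> = 0"
    and min: "\<And>g. g \<noteq> 0 \<Longrightarrow> poly (lift_poly g) \<alpha> = 0 \<Longrightarrow> degree f \<le> degree g"
    using ex_has_least_nat[of "\<lambda>g. g \<noteq> 0 \<and> poly (lift_poly g) \<alpha> = 0" p degree] by blast
  have unit: "b dvd 1" if ab: "f = a * b" and a: "poly (lift_poly a) \<alpha> = 0" for a b
  proof -
    from ab f(1) have nz: "a \<noteq> 0" "b \<noteq> 0" by auto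
    then have "degree f = degree a + degree b" by (simp add: ab degree_mult_eq)
    with min[OF nz(1) a] have "degree b = 0" by simp
    with nz(2) show ?thesis by (simp add: is_unit_iff_degree)
  qed
  have "irreducible f"
  proof (rule irreducibleI)
    show "\<not> f dvd 1" using f(2) by (rule not_unit_of_root)
    fix a b assume ab: "f = a * b"
    then have "poly (lift_poly a) \<alpha> = 0 \<or> poly (lift_poly b) \<alpha> = 0"
      using f(2) by (simp add: lift_poly_mult)
    then show "a dvd 1 \<or> b dvd 1"
      using unit[of a b] unit[of b a] ab by (auto simp: mult.commute)
  qed (use f in simp)
  with f(2) show ?thesis using that by blast
qed

section \<open>Extending isomorphisms to the algebraic closure\<close>

text \<open>
  The graph of an isomorphism over \<open>K\<close> between two intermediate fields, represented as a subring of the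
  product of the closure with itself that contains the diagonal copy of \<open>K\<close>. The last clause makes the
  relation single-valued and injective. With relations, unions of chains need no gluing of functions,
  and domain and range play symmetric parts, so that every statement about the domain gives one about
  the range by passing to the converse. Such a ring is closed under inverses because the closure is
  algebraic over \<open>K\<close> (\<open>partial_auto_inverse\<close>).
\<close>

definition partial_auto :: "('a::field alg_closure \<times> 'a alg_closure) set \<Rightarrow> bool"
  where "partial_auto R \<longleftrightarrow>
    (\<forall>c. (to_ac c, to_ac c) \<in> R) \<and>
    (\<forall>x y x' y'. (x, y) \<in> R \<and> (x', y') \<in> R \<longrightarrow> (x + x', y + y') \<in> R \<and> (x * x', y * y') \<in> R) \<and>
    (\<forall>x y. (x, y) \<in> R \<longrightarrow> (x = 0 \<longleftrightarrow> y = 0))"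

lemma partial_autoD:
  assumes "partial_auto R"
  shows "(to_ac c, to_ac c) \<in> R"
    and "(x, y) \<in> R \<Longrightarrow> (x', y') \<in> R \<Longrightarrow> (x + x', y + y') \<in> R"
    and "(x, y) \<in> R \<Longrightarrow> (x', y') \<in> R \<Longrightarrow> (x * x', y * y') \<in> R"
    and "(x, y) \<in> R \<Longrightarrow> x = 0 \<longleftrightarrow> y = 0"
  using assms unfolding partial_auto_def by blast+

lemma partial_auto_0: "partial_auto R \<Longrightarrow> (0, 0) \<in> R"
  using partial_autoD(1)[of R 0] by simp

lemma partial_auto_1: "partial_auto R \<Longrightarrow> (1, 1) \<in> R"
  using partial_autoD(1)[of R 1] by simp

lemma partial_auto_uminus:
  assumes "partial_auto R" "(x, y) \<in> R"
  shows "(- x, - y) \<in> R"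
  using partial_autoD(3)[OF assms(1) partial_autoD(1)[OF assms(1), of "-1"] assms(2)] by simp

lemma partial_auto_diff:
  assumes "partial_auto R" "(x, y) \<in> R" "(x', y') \<in> R"
  shows "(x - x', y - y') \<in> R"
  using partial_autoD(2)[OF assms(1,2) partial_auto_uminus[OF assms(1,3)]] by simp

lemma partial_auto_single_valued:
  assumes "partial_auto R" "(x, y) \<in> R" "(x, y') \<in> R"
  shows "y = y'"
  using partial_autoD(4)[OF assms(1) partial_auto_diff[OF assms]] by simp

lemma partial_auto_converse: "partial_auto R \<Longrightarrow> partial_auto (R\<inverse>)"
  unfolding partial_auto_def by simp

lemma partial_auto_poly:
  assumes "partial_auto R" "(x, y) \<in> R"
  shows "(poly (lift_poly g) x, poly (lift_poly g) y) \<in> R"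
proof (induction g)
  case 0
  then show ?case using partial_auto_0[OF assms(1)] by simp
next
  case (pCons a g)
  then show ?case
    using partial_autoD(1-3)[OF assms(1)] assms(2) by (simp add: map_poly_pCons)
qed

text \<open>
  A nonzero algebraic \<open>x\<close> satisfies an equation \<open>a + x h(x) = 0\<close> over \<open>K\<close> with \<open>a \<noteq> 0\<close>, so
  \<open>- h(x) / a\<close> is its inverse. The partner \<open>y\<close> satisfies the same equation.
\<close>

lemma partial_auto_inverse:
  assumes R: "partial_auto R" and xy: "(x, y) \<in> R"
  shows "(inverse x, inverse y) \<in> R"
proof (cases "x = 0")
  case True
  then show ?thesis using xy partial_autoD(4)[OF R xy] by simp
next
  case False
  with partial_autoD(4)[OF R xy] have nz: "x \<noteq> 0" "y \<noteq> 0" by auto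
  \<comment> \<open>Cancel powers of the variable until the constant coefficient is nonzero.\<close>
  have "\<exists>a h. a \<noteq> 0 \<and> to_ac a + x * poly (lift_poly h) x = 0"
    if "p \<noteq> 0" "poly (lift_poly p) x = 0" for p
    using that
  proof (induction p)
    case (pCons a p)
    show ?case
    proof (cases "a = 0")
      case True
      with pCons nz show ?thesis by (auto simp: map_poly_pCons)
    next
      case False
      with pCons.prems show ?thesis by (auto simp: map_poly_pCons)
    qed
  qed simp
  then obtain a h where ah: "a \<noteq> 0" "to_ac a + x * poly (lift_poly h) x = 0"
    using alg_closure_algebraic[of x] by metis
  note hR = partial_auto_poly[OF R xy, of h]
  have "(to_ac a + x * poly (lift_poly h) x, to_ac a + y * poly (lift_poly h) y) \<in> R"
    by (intro partial_autoD(2,3)[OF R] partial_autoD(1)[OF R] xy hR)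
  with partial_autoD(4)[OF R this] ah(2) have y: "to_ac a + y * poly (lift_poly h) y = 0"
    by simp
  have inv: "inverse z = to_ac (- inverse a) * poly (lift_poly h) z"
    if "to_ac a + z * poly (lift_poly h) z = 0" for z
  proof -
    from that have e: "to_ac a = - (z * poly (lift_poly h) z)"
      by (simp add: eq_neg_iff_add_eq_0)
    have "z * (to_ac (- inverse a) * poly (lift_poly h) z)
        = - inverse (to_ac a) * (z * poly (lift_poly h) z)"
      by (simp add: algebra_simps)
    also have "\<dots> = inverse (to_ac a) * to_ac a" by (simp only: e) simp
    also have "\<dots> = 1" using ah(1) by simp
    finally show ?thesis by (rule inverse_unique)
  qed
  show ?thesis
    unfolding inv[OF ah(2)] inv[OF y]
    by (intro partial_autoD(3)[OF R] partial_autoD(1)[OF R] hR)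
qed

text \<open>
  When \<open>R\<close> is the graph of \<open>\<sigma>\<close>, this says that \<open>A\<close> has coefficients in the domain of \<open>\<sigma>\<close> and that
  \<open>B\<close> arises from \<open>A\<close> by applying \<open>\<sigma>\<close> to them.
\<close>

definition poly_rel :: "('b::zero \<times> 'b) set \<Rightarrow> 'b poly \<Rightarrow> 'b poly \<Rightarrow> bool"
  where "poly_rel R A B \<longleftrightarrow> (\<forall>i. (coeff A i, coeff B i) \<in> R)"

lemma poly_rel_add:
  "partial_auto R \<Longrightarrow> poly_rel R A B \<Longrightarrow> poly_rel R A' B' \<Longrightarrow> poly_rel R (A + A') (B + B')"
  by (simp add: poly_rel_def partial_autoD(2))

lemma poly_rel_diff:
  "partial_auto R \<Longrightarrow> poly_rel R A B \<Longrightarrow> poly_rel R A' B' \<Longrightarrow> poly_rel R (A - A') (B - B')"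
  by (simp add: poly_rel_def partial_auto_diff)

lemma poly_rel_mult:
  assumes R: "partial_auto R" and "poly_rel R A B" "poly_rel R A' B'"
  shows "poly_rel R (A * A') (B * B')"
proof -
  have "((\<Sum>j\<in>J. coeff A j * coeff A' (n - j)), (\<Sum>j\<in>J. coeff B j * coeff B' (n - j))) \<in> R"
    if "finite J" for J and n
    using that assms
    by (induction J rule: finite_induct)
       (auto simp: poly_rel_def intro!: partial_auto_0 partial_autoD(2,3))
  then show ?thesis by (simp add: poly_rel_def coeff_mult)
qed

lemma poly_rel_monom:
  "partial_auto R \<Longrightarrow> (c, d) \<in> R \<Longrightarrow> poly_rel R (monom c n) (monom d n)"
  by (simp add: poly_rel_def partial_auto_0)

lemma poly_rel_lift: "partial_auto R \<Longrightarrow> poly_rel R (lift_poly g) (lift_poly g)"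
  by (simp add: poly_rel_def coeff_map_poly partial_autoD(1))

lemma poly_rel_converse: "poly_rel (R\<inverse>) B A \<longleftrightarrow> poly_rel R A B"
  by (simp add: poly_rel_def)

lemma poly_rel_zero_iff:
  assumes "partial_auto R" "poly_rel R A B"
  shows "A = 0 \<longleftrightarrow> B = 0"
  using assms by (auto simp: poly_eq_iff poly_rel_def dest: partial_autoD(4))

lemma poly_rel_degree:
  assumes "partial_auto R" "poly_rel R A B"
  shows "degree A = degree B"
proof -
  have "coeff A i = 0 \<longleftrightarrow> coeff B i = 0" for i
    using assms by (auto simp: poly_rel_def dest: partial_autoD(4))
  then show ?thesis by (simp add: degree_def)
qed

text \<open>
  Long division uses only field operations on the coefficients, so it can be carried out on both
  components in parallel.
\<close>

lemma poly_rel_division: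
  assumes R: "partial_auto R" and PQ: "poly_rel R P Q" "P \<noteq> 0" and "poly_rel R A B"
  shows "\<exists>C E D F. poly_rel R C E \<and> poly_rel R D F \<and> A = P * C + D \<and> B = Q * E + F \<and>
    (D = 0 \<or> degree D < degree P)"
  using \<open>poly_rel R A B\<close>
  \<comment> \<open>The shift by one in the measure separates \<open>A = 0\<close> from the nonzero constants.\<close>
proof (induction "if A = 0 then 0 else Suc (degree A)" arbitrary: A B rule: less_induct)
  case less
  show ?case
  proof (cases "A = 0 \<or> degree A < degree P")
    case True
    have "poly_rel R 0 0" by (simp add: poly_rel_def partial_auto_0[OF R])
    moreover have "A = P * 0 + A" "B = Q * 0 + B" by simp_all
    ultimately show ?thesis using less.prems True by blast
  next
    case False
    define n where "n = degree A - degree P"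
    define c where "c = lead_coeff A * inverse (lead_coeff P)"
    define e where "e = lead_coeff B * inverse (lead_coeff Q)"
    have degs: "degree A = degree B" "degree P = degree Q"
      using poly_rel_degree[OF R] less.prems PQ by auto
    have "(c, e) \<in> R"
      using less.prems PQ(1) unfolding c_def e_def degs poly_rel_def
      by (intro partial_autoD(3)[OF R] partial_auto_inverse[OF R]) auto
    then have M: "poly_rel R (monom c n) (monom e n)" by (rule poly_rel_monom[OF R])
    define A' where "A' = A - P * monom c n"
    define B' where "B' = B - Q * monom e n"
    have rel: "poly_rel R A' B'"
      unfolding A'_def B'_def
      by (intro poly_rel_diff[OF R] poly_rel_mult[OF R] less.prems PQ(1) M)
    have n: "degree A = degree P + n" using False by (simp add: n_def)
    have "degree (P * monom c n) \<le> degree A"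
      unfolding n by (rule order_trans[OF degree_mult_le]) (simp add: degree_monom_le)
    then have le: "degree A' \<le> degree A" unfolding A'_def by (simp add: degree_diff_le)
    have "coeff (P * monom c n) (degree A) = lead_coeff P * c"
      by (simp add: n mult.commute[of P] coeff_monom_mult mult.commute[of c])
    also have "\<dots> = lead_coeff A" using PQ(2) by (simp add: c_def)
    finally have "coeff A' (degree A) = 0" by (simp add: A'_def)
    then have "A' = 0 \<or> degree A' < degree A"
      using le by (metis le_neq_implies_less leading_coeff_0_iff)
    with False have "(if A' = 0 then 0 else Suc (degree A')) < (if A = 0 then 0 else Suc (degree A))"
      by auto
    from less.hyps[OF this rel] obtain C E D F where CE: "poly_rel R C E" "poly_rel R D F"
      "A' = P * C + D" "B' = Q * E + F" "D = 0 \<or> degree D < degree P" by blast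
    have "A = P * (C + monom c n) + D" "B = Q * (E + monom e n) + F"
      using CE(3,4) by (simp_all add: A'_def B'_def algebra_simps)
    with CE(2,5) poly_rel_add[OF R CE(1) M] show ?thesis by blast
  qed
qed

text \<open>
  The ring generated by \<open>R\<close> and the pair \<open>(x, y)\<close>, that is, the extension of the isomorphism \<open>R\<close> that
  sends \<open>x\<close> to \<open>y\<close>.
\<close>

definition adjoin :: "('b::comm_ring_1 \<times> 'b) set \<Rightarrow> 'b \<Rightarrow> 'b \<Rightarrow> ('b \<times> 'b) set"
  where "adjoin R x y = {(poly A x, poly B y) | A B. poly_rel R A B}"

lemma adjoin_superset:
  assumes "partial_auto R"
  shows "R \<subseteq> adjoin R x y" "(x, y) \<in> adjoin R x y"
proof -
  show "R \<subseteq> adjoin R x y"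
  proof
    fix z assume z: "z \<in> R"
    then have "poly_rel R [:fst z:] [:snd z:]"
      by (auto simp: poly_rel_def coeff_pCons partial_auto_0[OF assms] split: nat.split)
    then have "(poly [:fst z:] x, poly [:snd z:] y) \<in> adjoin R x y"
      unfolding adjoin_def by blast
    then show "z \<in> adjoin R x y" by simp
  qed
  have "poly_rel R [:0, 1:] [:0, 1:]"
    by (auto simp: poly_rel_def coeff_pCons partial_auto_0[OF assms] partial_auto_1[OF assms]
        split: nat.split)
  then have "(poly [:0, 1:] x, poly [:0, 1:] y) \<in> adjoin R x y"
    unfolding adjoin_def by blast
  then show "(x, y) \<in> adjoin R x y" by simp
qed

text \<open>
  \<open>P\<close> is a minimal polynomial of \<open>x\<close> over the domain of \<open>R\<close>. Every \<open>A\<close> that vanishes at \<open>x\<close> is a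
  multiple of \<open>P\<close>, hence its partner \<open>B\<close> is a multiple of \<open>Q\<close>.
\<close>

lemma poly_rel_root_transfer:
  assumes R: "partial_auto R" and PQ: "poly_rel R P Q" "P \<noteq> 0" "poly P x = 0" "poly Q y = 0"
    and min: "\<And>A B. poly_rel R A B \<Longrightarrow> A \<noteq> 0 \<Longrightarrow> poly A x = 0 \<Longrightarrow> degree P \<le> degree A"
    and AB: "poly_rel R A B" "poly A x = 0"
  shows "poly B y = 0"
proof -
  obtain C E D F where CE: "poly_rel R D F" "A = P * C + D" "B = Q * E + F"
    "D = 0 \<or> degree D < degree P"
    using poly_rel_division[OF R PQ(1,2) AB(1)] by blast
  have "poly D x = 0" using AB(2) PQ(3) by (simp add: CE(2))
  with min[OF CE(1)] CE(4) have "D = 0" by fastforce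
  then have "F = 0" using poly_rel_zero_iff[OF R CE(1)] by simp
  then show ?thesis using PQ(4) by (simp add: CE(3))
qed

text \<open>
  The point is that \<open>A(x) = 0\<close> exactly when \<open>B(y) = 0\<close> for related \<open>A\<close> and \<open>B\<close>. One direction is
  \<open>poly_rel_root_transfer\<close>; the other is the same lemma for the converse relation, once \<open>Q\<close> is known
  to be minimal for \<open>y\<close>.
\<close>

lemma partial_auto_adjoin:
  assumes R: "partial_auto R" and PQ: "poly_rel R P Q" "P \<noteq> 0" "poly P x = 0" "poly Q y = 0"
    and min: "\<And>A B. poly_rel R A B \<Longrightarrow> A \<noteq> 0 \<Longrightarrow> poly A x = 0 \<Longrightarrow> degree P \<le> degree A"
  shows "partial_auto (adjoin R x y)"
proof -
  \<comment> \<open>A minimal \<open>B0\<close> for \<open>y\<close> divides \<open>Q\<close>, so its partner \<open>A0\<close> divides \<open>P\<close>. Since \<open>x\<close> is a root of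
    \<open>A0\<close> or of the cofactor, minimality of \<open>P\<close> leaves no room for a factor of lower degree.\<close>
  have min': "degree P \<le> degree B"
    if AB: "poly_rel R A B" "B \<noteq> 0" "poly B y = 0" for A B
  proof -
    from AB obtain A0 B0 where m: "poly_rel R A0 B0" "B0 \<noteq> 0" "poly B0 y = 0"
      and least: "\<And>A B. poly_rel R A B \<Longrightarrow> B \<noteq> 0 \<Longrightarrow> poly B y = 0 \<Longrightarrow> degree B0 \<le> degree B"
      using ex_has_least_nat[of "\<lambda>z. poly_rel R (fst z) (snd z) \<and> snd z \<noteq> 0 \<and> poly (snd z) y = 0"
          "(A, B)" "\<lambda>z. degree (snd z)"] by auto
    have nz: "A0 \<noteq> 0" using m poly_rel_zero_iff[OF R] by blast
    obtain C E D F where CE: "poly_rel R C E" "poly_rel R D F" "P = A0 * C + D" "Q = B0 * E + F"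
      "D = 0 \<or> degree D < degree A0"
      using poly_rel_division[OF R m(1) nz PQ(1)] by blast
    have "poly F y = 0" using PQ(4) m(3) by (simp add: CE(4))
    with least[OF CE(2)] CE(5) have "D = 0"
      using poly_rel_degree[OF R CE(2)] poly_rel_degree[OF R m(1)] poly_rel_zero_iff[OF R CE(2)]
      by fastforce
    then have P: "P = A0 * C" by (simp add: CE(3))
    with PQ(2) have C: "C \<noteq> 0" by auto
    have dP: "degree P = degree A0 + degree C" using nz C by (simp add: P degree_mult_eq)
    have "degree B0 \<noteq> 0" using degree_neq_0_of_root m(2,3) by blast
    then have pos: "degree A0 > 0" using poly_rel_degree[OF R m(1)] by simp
    have "poly A0 x = 0 \<or> poly C x = 0" using PQ(3) by (simp add: P)
    then have "degree P \<le> degree A0"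
      using min[OF m(1) nz] min[OF CE(1) C] dP pos by fastforce
    also have "\<dots> = degree B0" by (rule poly_rel_degree[OF R m(1)])
    also have "\<dots> \<le> degree B" using least[OF AB] .
    finally show ?thesis .
  qed
  have iff: "poly A x = 0 \<longleftrightarrow> poly B y = 0" if AB: "poly_rel R A B" for A B
  proof
    assume "poly A x = 0"
    then show "poly B y = 0" using poly_rel_root_transfer[OF R PQ _ AB] min by blast
  next
    assume By: "poly B y = 0"
    show "poly A x = 0"
    proof (rule poly_rel_root_transfer[OF partial_auto_converse[OF R], of Q P y x B A])
      show "poly_rel (R\<inverse>) Q P" "poly_rel (R\<inverse>) B A" using PQ(1) AB by (simp_all add: poly_rel_converse)
      show "Q \<noteq> 0" using PQ(1,2) poly_rel_zero_iff[OF R] by blast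
      show "degree Q \<le> degree A'" if "poly_rel (R\<inverse>) A' B'" "A' \<noteq> 0" "poly A' y = 0" for A' B'
        using min'[of B' A'] that poly_rel_degree[OF R PQ(1)] by (simp add: poly_rel_converse)
    qed (use PQ By in auto)
  qed
  show ?thesis
    unfolding partial_auto_def
  proof (intro conjI allI impI)
    fix c show "(to_ac c, to_ac c) \<in> adjoin R x y"
      using adjoin_superset(1)[OF R] partial_autoD(1)[OF R] by blast
  next
    fix u v u' v' assume uv: "(u, v) \<in> adjoin R x y \<and> (u', v') \<in> adjoin R x y"
    then obtain A B A' B' where eq: "u = poly A x" "v = poly B y" "u' = poly A' x" "v' = poly B' y"
      and rel: "poly_rel R A B" "poly_rel R A' B'"
      unfolding adjoin_def by blast
    show "(u + u', v + v') \<in> adjoin R x y"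
      unfolding adjoin_def eq poly_add[symmetric] using poly_rel_add[OF R rel] by blast
    show "(u * u', v * v') \<in> adjoin R x y"
      unfolding adjoin_def eq poly_mult[symmetric] using poly_rel_mult[OF R rel] by blast
  next
    fix u v assume "(u, v) \<in> adjoin R x y"
    then obtain A B where "u = poly A x" "v = poly B y" "poly_rel R A B"
      unfolding adjoin_def by blast
    then show "u = 0 \<longleftrightarrow> v = 0" using iff by simp
  qed
qed

text \<open>
  Send \<open>x\<close> to any root of the transported minimal polynomial.
\<close>

lemma partial_auto_extend:
  fixes x :: "'a::field alg_closure"
  assumes R: "partial_auto R"
  shows "\<exists>y R'. partial_auto R' \<and> R \<subseteq> R' \<and> (x, y) \<in> R'"
proof -
  obtain p :: "'a poly" where "p \<noteq> 0" "poly (lift_poly p) x = 0"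
    using alg_closure_algebraic[of x] by blast
  then have "poly_rel R (lift_poly p) (lift_poly p) \<and> lift_poly p \<noteq> 0 \<and> poly (lift_poly p) x = 0"
    by (simp add: poly_rel_lift[OF R] lift_poly_eq_0_iff)
  then obtain P Q where PQ: "poly_rel R P Q" "P \<noteq> 0" "poly P x = 0"
    and min: "\<And>A B. poly_rel R A B \<Longrightarrow> A \<noteq> 0 \<Longrightarrow> poly A x = 0 \<Longrightarrow> degree P \<le> degree A"
    using ex_has_least_nat[of "\<lambda>z. poly_rel R (fst z) (snd z) \<and> fst z \<noteq> 0 \<and> poly (fst z) x = 0"
        "(lift_poly p, lift_poly p)" "\<lambda>z. degree (fst z)"] by auto
  have "degree P \<noteq> 0" using degree_neq_0_of_root PQ(2,3) by blast
  then have "degree Q > 0" using poly_rel_degree[OF R PQ(1)] by simp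
  then obtain y where y: "poly Q y = 0" using alg_closed_imp_poly_has_root by blast
  have "partial_auto (adjoin R x y)" by (rule partial_auto_adjoin[OF R PQ y]) (rule min)
  with adjoin_superset[OF R] show ?thesis by blast
qed

text \<open>
  A maximal extension is defined everywhere by \<open>partial_auto_extend\<close>. Its converse is maximal as well,
  so it is also onto.
\<close>

lemma partial_auto_total:
  assumes "partial_auto R"
  obtains \<sigma> where "\<sigma> \<in> abs_galois" "\<And>x y. (x, y) \<in> R \<Longrightarrow> \<sigma> x = y"
proof -
  define \<A> where "\<A> = {M. partial_auto M \<and> R \<subseteq> M}"
  have "\<exists>M\<in>\<A>. \<forall>N\<in>\<A>. M \<subseteq> N \<longrightarrow> N = M"
  proof (rule subset_Zorn_nonempty)
    show "\<A> \<noteq> {}" using assms by (auto simp: \<A>_def)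
    fix \<C> assume \<C>: "\<C> \<noteq> {}" "subset.chain \<A> \<C>"
    then have mem: "partial_auto M" "R \<subseteq> M" if "M \<in> \<C>" for M
      using that by (auto simp: \<A>_def subset_chain_def)
    have chain: "M \<subseteq> N \<or> N \<subseteq> M" if "M \<in> \<C>" "N \<in> \<C>" for M N
      using \<C>(2) that unfolding subset_chain_def by blast
    from \<C>(1) obtain M0 where M0: "M0 \<in> \<C>" by blast
    have "partial_auto (\<Union>\<C>)"
      unfolding partial_auto_def
    proof (intro conjI allI impI)
      fix c show "(to_ac c, to_ac c) \<in> \<Union>\<C>" using M0 partial_autoD(1)[OF mem(1)] by blast
    next
      fix x y x' y' assume "(x, y) \<in> \<Union>\<C> \<and> (x', y') \<in> \<Union>\<C>"
      then obtain M1 M2 where "M1 \<in> \<C>" "(x, y) \<in> M1" "M2 \<in> \<C>" "(x', y') \<in> M2" by blast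
      with chain[of M1 M2] obtain M where M: "M \<in> \<C>" "(x, y) \<in> M" "(x', y') \<in> M" by blast
      show "(x + x', y + y') \<in> \<Union>\<C>" "(x * x', y * y') \<in> \<Union>\<C>"
        using partial_autoD(2,3)[OF mem(1)[OF M(1)] M(2,3)] M(1) by blast+
    next
      fix x y assume "(x, y) \<in> \<Union>\<C>"
      then show "x = 0 \<longleftrightarrow> y = 0" using partial_autoD(4)[OF mem(1)] by blast
    qed
    then show "\<Union>\<C> \<in> \<A>" using M0 mem by (auto simp: \<A>_def)
  qed
  then obtain M where M: "partial_auto M" "R \<subseteq> M"
    and max: "\<And>N. partial_auto N \<Longrightarrow> M \<subseteq> N \<Longrightarrow> N = M"
    unfolding \<A>_def by auto
  have dom: "\<exists>y. (x, y) \<in> M" for x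
  proof -
    obtain y N where "partial_auto N" "M \<subseteq> N" "(x, y) \<in> N"
      using partial_auto_extend[OF M(1)] by blast
    with max[of N] show ?thesis by blast
  qed
  have ran: "\<exists>x. (x, y) \<in> M" for y
  proof -
    obtain x N where N: "partial_auto N" "M\<inverse> \<subseteq> N" "(y, x) \<in> N"
      using partial_auto_extend[OF partial_auto_converse[OF M(1)]] by blast
    then have "N\<inverse> = M" by (intro max partial_auto_converse) auto
    with N(3) show ?thesis by blast
  qed
  define \<sigma> where "\<sigma> x = (THE y. (x, y) \<in> M)" for x
  have eq: "\<sigma> x = y" if "(x, y) \<in> M" for x y
    unfolding \<sigma>_def using that by (rule the_equality) (rule partial_auto_single_valued[OF M(1) _ that])
  have graph: "(x, \<sigma> x) \<in> M" for x
  proof -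
    obtain y where "(x, y) \<in> M" using dom by blast
    with eq[OF this] show ?thesis by simp
  qed
  have "bij \<sigma>"
  proof (rule bijI)
    show "inj \<sigma>"
    proof (rule injI)
      fix x x' assume "\<sigma> x = \<sigma> x'"
      then have "(\<sigma> x, x) \<in> M\<inverse>" "(\<sigma> x, x') \<in> M\<inverse>" using graph[of x] graph[of x'] by simp_all
      then show "x = x'" by (rule partial_auto_single_valued[OF partial_auto_converse[OF M(1)]])
    qed
    show "surj \<sigma>"
    proof (rule surjI)
      fix y show "\<sigma> (SOME x. (x, y) \<in> M) = y" using someI_ex[OF ran] by (rule eq)
    qed
  qed
  moreover have "\<sigma> (x + y) = \<sigma> x + \<sigma> y" "\<sigma> (x * y) = \<sigma> x * \<sigma> y" "\<sigma> (to_ac c) = to_ac c" for x y c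
    by (intro eq partial_autoD(1-3)[OF M(1)] graph)+
  moreover have "\<sigma> 1 = 1" by (intro eq partial_auto_1 M)
  ultimately have "\<sigma> \<in> abs_galois"
    by (simp add: abs_galois_def ring_iso_def ring_hom_def ring_of_type_algebra_def)
  with that eq M(2) show ?thesis by blast
qed

text \<open>
  The pairs \<open>(g(\<alpha>), g(\<beta>))\<close> with \<open>g\<close> over \<open>K\<close> are the graph of the isomorphism from \<open>K(\<alpha>)\<close> to
  \<open>K(\<beta>)\<close>: both \<open>g(\<alpha>) = 0\<close> and \<open>g(\<beta>) = 0\<close> mean that \<open>f\<close> divides \<open>g\<close>.
\<close>

lemma galois_transitive_on_roots:
  assumes "irreducible f" "poly (lift_poly f) \<alpha> = 0" "poly (lift_poly f) \<beta> = 0"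
  shows "\<exists>\<sigma>\<in>abs_galois. \<sigma> \<alpha> = \<beta>"
proof -
  define R where "R = range (\<lambda>g. (poly (lift_poly g) \<alpha>, poly (lift_poly g) \<beta>))"
  have memR: "(poly (lift_poly g) \<alpha>, poly (lift_poly g) \<beta>) \<in> R" for g by (auto simp: R_def)
  have "partial_auto R"
    unfolding partial_auto_def
  proof (intro conjI allI impI)
    fix c show "(to_ac c, to_ac c) \<in> R" using memR[of "[:c:]"] by (simp add: map_poly_pCons)
  next
    fix x y x' y' assume "(x, y) \<in> R \<and> (x', y') \<in> R"
    then obtain g g' where g: "x = poly (lift_poly g) \<alpha>" "y = poly (lift_poly g) \<beta>"
      "x' = poly (lift_poly g') \<alpha>" "y' = poly (lift_poly g') \<beta>"
      by (auto simp: R_def)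
    show "(x + x', y + y') \<in> R" "(x * x', y * y') \<in> R"
      using memR[of "g + g'"] memR[of "g * g'"] by (simp_all add: g lift_poly_add lift_poly_mult)
  next
    fix x y assume "(x, y) \<in> R"
    then show "x = 0 \<longleftrightarrow> y = 0"
      using irreducible_dvd_iff_root[OF assms(1,2)] irreducible_dvd_iff_root[OF assms(1,3)]
      by (auto simp: R_def)
  qed
  then obtain \<sigma> where \<sigma>: "\<sigma> \<in> abs_galois" "\<And>x y. (x, y) \<in> R \<Longrightarrow> \<sigma> x = y"
    by (rule partial_auto_total) blast
  have "(\<alpha>, \<beta>) \<in> R" using memR[of "[:0, 1:]"] by (simp add: map_poly_pCons)
  with \<sigma> show ?thesis by blast
qed

section \<open>The Wronskian of a rational function\<close>

text \<open>
  With \<open>F = (z - a)^e G\<close> and \<open>G(a) \<noteq> 0\<close>, the combination is \<open>(z - a)^(e - 1)\<close> times a polynomial whose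
  value at \<open>a\<close> is \<open>e G(a) q(a) \<noteq> 0\<close>. The case \<open>q = 1\<close> gives the order of the derivative.
\<close>

lemma order_wronskian:
  fixes F q :: "'b::field poly"
  assumes "F \<noteq> 0" "poly F a = 0" "of_nat (order a F) \<noteq> (0::'b)" "poly q a \<noteq> 0"
  shows "pderiv F * q - F * pderiv q \<noteq> 0"
    and "order a (pderiv F * q - F * pderiv q) = order a F - 1"
proof -
  obtain n where n: "order a F = Suc n"
    using assms(1,2) order_root[of F a] by (cases "order a F") auto
  define L where "L = [:-a, 1:]"
  obtain G where G: "F = L ^ Suc n * G" and ndvd: "\<not> L dvd G"
    using order_decomp[OF assms(1), of a] by (auto simp: n L_def)
  define H where "H = smult (of_nat (Suc n)) (G * q) + L * (pderiv G * q - G * pderiv q)"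
  have "pderiv L = 1" by (simp add: L_def pderiv_pCons)
  then have dF: "pderiv F = L ^ Suc n * pderiv G + G * smult (of_nat (Suc n)) (L ^ n)"
    by (simp only: G pderiv_mult pderiv_power_Suc mult_1_right)
  have "(L * E * G' + G * smult k E) * q - L * E * G * q' =
      E * (smult k (G * q) + L * (G' * q - G * q'))" for E G' q' k
    by (simp add: algebra_simps)
  then have eq: "pderiv F * q - F * pderiv q = L ^ n * H"
    by (simp only: dF H_def) (simp only: G power_Suc)
  have "poly G a \<noteq> 0" using ndvd by (simp add: poly_eq_0_iff_dvd L_def)
  then have "poly H a \<noteq> 0" using assms(3,4) by (simp add: H_def n L_def del: of_nat_Suc)
  then have nd: "\<not> L dvd H" by (simp add: poly_eq_0_iff_dvd L_def)
  then have "H \<noteq> 0" by auto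
  then show "pderiv F * q - F * pderiv q \<noteq> 0" by (simp add: eq L_def)
  have "order a (L ^ n * H) = n"
    using \<open>H \<noteq> 0\<close> nd unfolding L_def
    by (subst order_mult) (auto simp: order_power_n_n order_0I poly_eq_0_iff_dvd)
  then show "order a (pderiv F * q - F * pderiv q) = order a F - 1" by (simp add: eq n)
qed

lemma of_nat_neq_0_below_char:
  assumes "0 < n" "CHAR('b) = 0 \<or> n < CHAR('b)"
  shows "of_nat n \<noteq> (0::'b::semiring_1)"
  using assms by (auto simp: of_nat_eq_0_iff_char_dvd dest: dvd_imp_le)

text \<open>
  Let \<open>F = q(\<alpha>) p - p(\<alpha>) q\<close>, whose order at \<open>\<alpha>\<close> is the ramification index. Then
  \<open>F' q - F q' = q(\<alpha>) w\<close> and \<open>F' p - F p' = p(\<alpha>) w\<close> for the Wronskian \<open>w\<close>. Since \<open>p\<close> and \<open>q\<close> do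
  not both vanish at \<open>\<alpha>\<close>, \<open>order_wronskian\<close> applies to one of the two, which covers poles without a
  change of coordinates.
\<close>

lemma ram_index_wronskian:
  fixes \<phi> :: "'a::field poly fract"
  assumes d: "rat_degree \<phi> > 0" and char: "CHAR('a) = 0 \<or> rat_degree \<phi> < CHAR('a)"
  obtains w :: "'a poly" where "w \<noteq> 0"
    "\<And>\<alpha>. order \<alpha> (lift_poly w) = ram_index \<phi> (Pt \<alpha>) - 1"
    "\<And>\<alpha>. ram_index \<phi> (Pt \<alpha>) \<le> rat_degree \<phi>"
proof -
  define p q where "p = rat_num \<phi>" and "q = rat_den \<phi>"
  define P Q where "P = lift_poly p" and "Q = lift_poly q"
  define w where "w = pderiv p * q - p * pderiv q"
  have W: "lift_poly w = pderiv P * Q - P * pderiv Q"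
    by (simp add: w_def P_def Q_def lift_poly_diff lift_poly_mult lift_poly_pderiv)
  have "is_reduced \<phi> p q" unfolding p_def q_def by (rule num_den_reduced)
  then have qnz: "Q \<noteq> 0" and cop: "\<And>\<alpha>. \<not> (poly P \<alpha> = 0 \<and> poly Q \<alpha> = 0)"
    by (auto simp: is_reduced_def P_def Q_def lift_poly_eq_0_iff)
  have deg: "rat_degree \<phi> = max (degree P) (degree Q)"
    by (simp add: rat_degree_def P_def Q_def p_def q_def degree_map_poly)
  have *: "lift_poly w \<noteq> 0 \<and> order \<alpha> (lift_poly w) = ram_index \<phi> (Pt \<alpha>) - 1 \<and>
    ram_index \<phi> (Pt \<alpha>) \<le> rat_degree \<phi>" for \<alpha>
  proof -
    define F where "F = smult (poly Q \<alpha>) P - smult (poly P \<alpha>) Q"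
    have ram: "ram_index \<phi> (Pt \<alpha>) = order \<alpha> F"
      by (simp add: ram_index_affine_def F_def Let_def P_def Q_def p_def q_def)
    \<comment> \<open>If \<open>F = 0\<close> then \<open>p\<close> and \<open>q\<close> are proportional, and having no common root they are constant.\<close>
    have "F \<noteq> 0"
    proof
      assume "F = 0"
      then have eq: "smult (poly Q \<alpha>) P = smult (poly P \<alpha>) Q" by (simp add: F_def)
      have ev: "poly Q \<alpha> * poly P \<beta> = poly P \<alpha> * poly Q \<beta>" for \<beta>
        using arg_cong[OF eq, of "\<lambda>f. poly f \<beta>"] by simp
      show False
      proof (cases "poly Q \<alpha> = 0")
        case True
        with eq cop qnz show False by (metis smult_0_left smult_eq_0_iff)
      next
        case False
        have "degree Q = 0"
          using alg_closed_imp_poly_has_root[of Q] ev cop False by (metis mult_eq_0_iff mult_zero_right neq0_conv)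
        moreover have "degree P = 0"
        proof (cases "poly P \<alpha> = 0")
          case True
          with eq False show ?thesis by simp
        next
          case False
          then show ?thesis
            using alg_closed_imp_poly_has_root[of P] ev cop by (metis mult_eq_0_iff mult_zero_right neq0_conv)
        qed
        ultimately show False using d deg by simp
      qed
    qed
    have root: "poly F \<alpha> = 0" by (simp add: F_def)
    have le: "order \<alpha> F \<le> rat_degree \<phi>"
    proof -
      have "order \<alpha> F \<le> degree F" using order_degree[OF \<open>F \<noteq> 0\<close>] .
      also have "\<dots> \<le> rat_degree \<phi>"
        unfolding F_def deg by (intro degree_diff_le) (auto intro: order_trans[OF degree_smult_le])
      finally show ?thesis .
    qed
    have "order \<alpha> F > 0" using \<open>F \<noteq> 0\<close> root order_root by blast
    then have nz: "of_nat (order \<alpha> F) \<noteq> (0 :: 'a alg_closure)"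
      using le char by (intro of_nat_neq_0_below_char) auto
    consider "poly Q \<alpha> \<noteq> 0" | "poly P \<alpha> \<noteq> 0" using cop by blast
    then show ?thesis
    proof cases
      case 1
      have "smult (poly Q \<alpha>) (lift_poly w) = pderiv F * Q - F * pderiv Q"
        by (simp add: W F_def pderiv_diff pderiv_smult algebra_simps smult_diff_right)
      with order_wronskian[OF \<open>F \<noteq> 0\<close> root nz 1] 1 show ?thesis
        using le by (metis order_smult ram smult_eq_0_iff)
    next
      case 2
      have "smult (poly P \<alpha>) (lift_poly w) = pderiv F * P - F * pderiv P"
        by (simp add: W F_def pderiv_diff pderiv_smult algebra_simps smult_diff_right)
      with order_wronskian[OF \<open>F \<noteq> 0\<close> root nz 2] 2 show ?thesis
        using le by (metis order_smult ram smult_eq_0_iff)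
    qed
  qed
  then have "w \<noteq> 0" by auto
  with * that show ?thesis by blast
qed

section \<open>Irreducible polynomials with at most two roots\<close>

text \<open>
  A multiple root forces \<open>f\<close> to divide its own derivative. Then the derivative vanishes at \<open>\<alpha>\<close> at least
  to the order of \<open>f\<close>, whereas differentiation lowers that order by one when it is invertible in the
  field.
\<close>

lemma irreducible_simple_roots:
  fixes f :: "'a::field poly"
  assumes f: "irreducible f" "poly (lift_poly f) \<alpha> = 0"
    and "of_nat (order \<alpha> (lift_poly f)) \<noteq> (0 :: 'a alg_closure)"
    and \<beta>: "poly (lift_poly f) \<beta> = 0"
  shows "poly (pderiv (lift_poly f)) \<beta> \<noteq> 0"
proof
  assume "poly (pderiv (lift_poly f)) \<beta> = 0"
  then have "f dvd pderiv f"
    using irreducible_dvd_iff_root[OF f(1) \<beta>, of "pderiv f"] by (simp add: lift_poly_pderiv)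
  then have dvd: "lift_poly f dvd pderiv (lift_poly f)"
    using lift_poly_dvd by (metis lift_poly_pderiv)
  have nz: "lift_poly f \<noteq> 0" using f(1) by (rule irreducible_lift_nonzero)
  have "pderiv (lift_poly f) \<noteq> 0" "order \<alpha> (pderiv (lift_poly f)) = order \<alpha> (lift_poly f) - 1"
    using order_wronskian[OF nz f(2) assms(3), of 1] by simp_all
  moreover have "order \<alpha> (lift_poly f) > 0" using nz f(2) order_root by blast
  ultimately show False using dvd_imp_order_le[OF _ dvd, of \<alpha>] by simp
qed

text \<open>
  The irreducible factor of \<open>w\<close> at \<open>\<alpha>\<close> has only simple roots, by the bound on the multiplicity of
  \<open>\<alpha>\<close>, and all of them are among \<open>\<alpha>\<close> and \<open>\<beta>\<close>. If \<open>\<alpha>\<close> were the only one, the factor would be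
  linear and \<open>\<alpha>\<close> would lie in \<open>K\<close>. The points \<open>\<alpha>\<close> and \<open>\<beta>\<close> may coincide in the hypotheses; their
  distinctness is a conclusion, which is how infinity is excluded as the second critical point.
\<close>

lemma quadratic_factor:
  fixes \<alpha> \<beta> :: "'a::field alg_closure"
  assumes w: "w \<noteq> 0" "poly (lift_poly w) \<alpha> = 0"
    and char: "CHAR('a) = 0 \<or> order \<alpha> (lift_poly w) < CHAR('a)"
    and roots: "\<And>x. poly (lift_poly w) x = 0 \<Longrightarrow> x = \<alpha> \<or> x = \<beta>"
    and \<alpha>: "\<alpha> \<notin> range to_ac"
  obtains f a b where "irreducible f" "poly (lift_poly f) \<alpha> = 0" "poly (lift_poly f) \<beta> = 0"
    "\<alpha> \<noteq> \<beta>" "\<alpha> + \<beta> = to_ac a" "\<alpha> * \<beta> = to_ac b"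
proof -
  obtain f where f: "irreducible f" "poly (lift_poly f) \<alpha> = 0"
    using irreducible_poly_exists by blast
  have nz: "lift_poly f \<noteq> 0" using f(1) by (rule irreducible_lift_nonzero)
  have dvd: "lift_poly f dvd lift_poly w"
    using irreducible_dvd_iff_root[OF f] w(2) lift_poly_dvd by blast
  have "order \<alpha> (lift_poly f) \<le> order \<alpha> (lift_poly w)"
    using dvd_imp_order_le[OF _ dvd] w(1) by (simp add: lift_poly_eq_0_iff)
  moreover have "order \<alpha> (lift_poly f) > 0" using nz f(2) order_root by blast
  ultimately have "of_nat (order \<alpha> (lift_poly f)) \<noteq> (0 :: 'a alg_closure)"
    using char by (intro of_nat_neq_0_below_char) auto
  note simple = irreducible_simple_roots[OF f this]
  have froots: "x = \<alpha> \<or> x = \<beta>" if "poly (lift_poly f) x = 0" for x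
    using that dvd roots[of x] by (auto elim!: dvdE)
  have not_sq: "\<not> [:-x, 1:] * [:-x, 1:] dvd lift_poly f" for x
  proof
    assume "[:-x, 1:] * [:-x, 1:] dvd lift_poly f"
    then obtain k where "lift_poly f = [:-x, 1:] * [:-x, 1:] * k" by (rule dvdE)
    then have "poly (lift_poly f) x = 0" "poly (pderiv (lift_poly f)) x = 0"
      by (simp_all only: pderiv_mult poly_add poly_mult) simp_all
    with simple show False by blast
  qed
  obtain G where G: "lift_poly f = [:-\<alpha>, 1:] * G"
    using f(2) by (auto simp: poly_eq_0_iff_dvd)
  have "degree G \<noteq> 0"
  proof
    assume "degree G = 0"
    then obtain c where c: "G = [:c:]" by (rule degree_eq_zeroE)
    have "to_ac (coeff f i) = coeff ([:-\<alpha>, 1:] * G) i" for i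
      by (simp only: G[symmetric] coeff_map_poly to_ac_0)
    from this[of 0] this[of 1] have "to_ac (coeff f 0) = - (\<alpha> * c)" "to_ac (coeff f 1) = c"
      by (simp_all add: c)
    moreover have "c \<noteq> 0" using nz by (auto simp: G c)
    ultimately have "\<alpha> = to_ac (- coeff f 0 / coeff f 1)" by simp
    with \<alpha> show False by blast
  qed
  then obtain x where x: "poly G x = 0" using alg_closed_imp_poly_has_root by blast
  have "x \<noteq> \<alpha>"
  proof
    assume "x = \<alpha>"
    with x obtain k where "G = [:-\<alpha>, 1:] * k" by (auto simp: poly_eq_0_iff_dvd)
    then have "lift_poly f = [:-\<alpha>, 1:] * [:-\<alpha>, 1:] * k" by (simp only: G mult.assoc)
    with not_sq[of \<alpha>] show False by (metis dvd_triv_left)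
  qed
  with froots[of x] x have "x = \<beta>" by (simp add: G)
  with x obtain H where H: "G = [:-\<beta>, 1:] * H" by (auto simp: poly_eq_0_iff_dvd)
  have "degree H = 0"
  proof (rule ccontr)
    assume "degree H \<noteq> 0"
    then obtain y where "poly H y = 0" using alg_closed_imp_poly_has_root by blast
    then obtain J where J: "H = [:-y, 1:] * J" by (auto simp: poly_eq_0_iff_dvd)
    have "y = \<alpha> \<or> y = \<beta>" using froots[of y] by (simp add: G H J)
    moreover have "lift_poly f = [:-\<alpha>, 1:] * [:-y, 1:] * ([:-\<beta>, 1:] * J)"
      "lift_poly f = [:-\<beta>, 1:] * [:-y, 1:] * ([:-\<alpha>, 1:] * J)"
      unfolding G H J by (simp_all only: ac_simps)
    then have "[:-\<alpha>, 1:] * [:-y, 1:] dvd lift_poly f" "[:-\<beta>, 1:] * [:-y, 1:] dvd lift_poly f"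
      by (metis dvd_triv_left)+
    ultimately show False using not_sq by blast
  qed
  then obtain h where h: "H = [:h:]" by (rule degree_eq_zeroE)
  have "h \<noteq> 0" using nz G H h by auto
  have "to_ac (coeff f i) = coeff ([:-\<alpha>, 1:] * ([:-\<beta>, 1:] * [:h:])) i" for i
    by (simp only: h[symmetric] H[symmetric] G[symmetric] coeff_map_poly to_ac_0)
  from this[of 0] this[of 1] this[of 2]
  have eqs: "to_ac (coeff f 0) = h * (\<alpha> * \<beta>)" "to_ac (coeff f 1) = - (h * (\<alpha> + \<beta>))"
    "to_ac (coeff f 2) = h"
    by (simp_all add: numeral_2_eq_2 algebra_simps)
  have "\<alpha> + \<beta> = to_ac (- coeff f 1 / coeff f 2)" "\<alpha> * \<beta> = to_ac (coeff f 0 / coeff f 2)"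
    unfolding to_ac_divide to_ac_minus eqs using \<open>h \<noteq> 0\<close> by simp_all
  moreover have "poly (lift_poly f) \<beta> = 0" by (simp add: G H)
  moreover have "\<alpha> \<noteq> \<beta>" using \<open>x \<noteq> \<alpha>\<close> \<open>x = \<beta>\<close> by simp
  ultimately show ?thesis using that f by blast
qed

section \<open>Quadratic extensions inside the closure\<close>

lemma closure_ring_inv:
  assumes "h \<noteq> 0" shows "inv\<^bsub>closure_ring\<^esub> h = inverse (h :: 'a::field alg_closure)"
proof -
  interpret cring "closure_ring :: 'a alg_closure ring" by (rule cring_from_type_algebra)
  show ?thesis
    by (rule comm_inv_char) (use assms in \<open>simp_all add: ring_of_type_algebra_def\<close>)
qed

lemma closure_ring_a_inv: "\<ominus>\<^bsub>closure_ring\<^esub> h = - (h :: 'a::field alg_closure)"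
proof -
  interpret cring "closure_ring :: 'a alg_closure ring" by (rule cring_from_type_algebra)
  show ?thesis
    by (rule minus_equality) (simp_all add: ring_of_type_algebra_def)
qed

lemma generate_field_least:
  fixes E :: "'a::field alg_closure set"
  assumes "S \<subseteq> E" "1 \<in> E" "\<And>x. x \<in> E \<Longrightarrow> - x \<in> E" "\<And>x. x \<in> E \<Longrightarrow> x \<noteq> 0 \<Longrightarrow> inverse x \<in> E"
    "\<And>x y. x \<in> E \<Longrightarrow> y \<in> E \<Longrightarrow> x + y \<in> E" "\<And>x y. x \<in> E \<Longrightarrow> y \<in> E \<Longrightarrow> x * y \<in> E"
  shows "generate_field closure_ring S \<subseteq> E"
proof
  have ops: "\<one>\<^bsub>closure_ring\<^esub> = (1 :: 'a alg_closure)" "\<zero>\<^bsub>closure_ring\<^esub> = (0 :: 'a alg_closure)"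
    "(\<oplus>\<^bsub>closure_ring\<^esub>) = ((+) :: 'a alg_closure \<Rightarrow> _)"
    "(\<otimes>\<^bsub>closure_ring\<^esub>) = ((*) :: 'a alg_closure \<Rightarrow> _)"
    by (simp_all add: ring_of_type_algebra_def)
  fix x assume "x \<in> generate_field closure_ring S"
  then show "x \<in> E"
    by induction (use assms in \<open>auto simp: ops closure_ring_inv closure_ring_a_inv\<close>)
qed

lemma field_gen_of_rational_points:
  fixes S :: "'a::field alg_closure proj_line set"
  assumes "\<And>\<alpha>. Pt \<alpha> \<in> S \<Longrightarrow> \<alpha> \<in> base_field"
  shows "field_gen S = base_field"
proof
  show "field_gen S \<subseteq> base_field"
    unfolding field_gen_def
  proof (rule generate_field_least)
    show "1 \<in> (base_field :: 'a alg_closure set)" using to_ac_1 by (metis rangeI)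
    show "- x \<in> base_field" if "x \<in> base_field" for x :: "'a alg_closure"
      using that by (elim rangeE) (simp flip: to_ac_minus)
    show "inverse x \<in> base_field" if "x \<in> base_field" for x :: "'a alg_closure"
      using that by (elim rangeE) (simp flip: to_ac_inverse)
    show "x + y \<in> base_field" "x * y \<in> base_field"
      if "x \<in> base_field" "y \<in> base_field" for x y :: "'a alg_closure"
      using that by (elim rangeE, simp flip: to_ac_add to_ac_mult)+
  qed (use assms in auto)
  show "base_field \<subseteq> field_gen S" by (auto simp: field_gen_def intro: generate_field.incl)
qed

text \<open>
  The span of \<open>1\<close> and \<open>\<alpha>\<close> is closed under products because \<open>\<alpha>\<close> satisfies
  \<open>\<alpha>^2 = a \<alpha> - b\<close>, and under inverses because \<open>(u + v \<alpha>) (u + v \<beta>)\<close> is the norm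
  \<open>u^2 + a u v + b v^2\<close>, which lies in \<open>K\<close>.
\<close>

lemma field_gen_quadratic:
  fixes \<alpha> \<beta> :: "'a::field alg_closure"
  assumes \<alpha>: "\<alpha> \<notin> base_field" and sum: "\<alpha> + \<beta> = to_ac a" and prd: "\<alpha> * \<beta> = to_ac b"
  shows "field_gen {Pt \<alpha>, Pt \<beta>} = range (\<lambda>(u, v). to_ac u + to_ac v * \<alpha>)" (is "_ = ?E")
proof
  have memE: "to_ac u + to_ac v * \<alpha> \<in> ?E" for u v by (rule range_eqI[of _ _ "(u, v)"]) simp
  have \<beta>: "\<beta> = to_ac a - \<alpha>" using sum by (simp add: algebra_simps)
  have sq: "\<alpha> * \<alpha> = to_ac a * \<alpha> - to_ac b" using prd by (simp add: \<beta> algebra_simps)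
  have base: "to_ac c \<in> ?E" for c using memE[of c 0] by simp
  have mult: "x * y \<in> ?E" if "x \<in> ?E" "y \<in> ?E" for x y
  proof -
    from that obtain u v u' v' where xy: "x = to_ac u + to_ac v * \<alpha>" "y = to_ac u' + to_ac v' * \<alpha>"
      by auto
    have "x * y = to_ac (u * u') + to_ac (u * v' + v * u') * \<alpha> + to_ac (v * v') * (\<alpha> * \<alpha>)"
      by (simp add: xy algebra_simps)
    also have "\<dots> = to_ac (u * u' - v * v' * b) + to_ac (u * v' + v * u' + v * v' * a) * \<alpha>"
      by (simp add: sq algebra_simps)
    finally show ?thesis using memE by metis
  qed
  show "field_gen {Pt \<alpha>, Pt \<beta>} \<subseteq> ?E"
    unfolding field_gen_def
  proof (rule generate_field_least)
    have "\<alpha> \<in> ?E" "\<beta> \<in> ?E" using memE[of 0 1] memE[of a "-1"] by (simp_all add: \<beta>)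
    moreover have "base_field \<subseteq> ?E" using base by (rule image_subsetI)
    moreover have "{\<gamma>. Pt \<gamma> \<in> {Pt \<alpha>, Pt \<beta>}} = {\<alpha>, \<beta>}" by auto
    ultimately show "base_field \<union> {\<gamma>. Pt \<gamma> \<in> {Pt \<alpha>, Pt \<beta>}} \<subseteq> ?E" by simp
    show "1 \<in> ?E" using base[of 1] by simp
    show "- x \<in> ?E" if "x \<in> ?E" for x
      using mult[OF base[of "-1"] that] by simp
    show "x + y \<in> ?E" if xy: "x \<in> ?E" "y \<in> ?E" for x y
    proof -
      from that obtain u v u' v' where xy: "x = to_ac u + to_ac v * \<alpha>" "y = to_ac u' + to_ac v' * \<alpha>"
        by auto
      show ?thesis using memE[of "u + u'" "v + v'"] by (simp add: xy algebra_simps)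
    qed
    show "x * y \<in> ?E" if "x \<in> ?E" "y \<in> ?E" for x y using that by (rule mult)
    show "inverse x \<in> ?E" if x: "x \<in> ?E" "x \<noteq> 0" for x
    proof -
      from x obtain u v where uv: "x = to_ac u + to_ac v * \<alpha>" by auto
      define y where "y = to_ac u + to_ac v * \<beta>"
      define n where "n = u * u + u * v * a + v * v * b"
      have xy: "x * y = to_ac n"
      proof -
        have "x * y = to_ac u * to_ac u + to_ac u * to_ac v * (\<alpha> + \<beta>) + to_ac v * to_ac v * (\<alpha> * \<beta>)"
          by (simp add: uv y_def algebra_simps)
        then show ?thesis by (simp add: sum prd n_def)
      qed
      show ?thesis
      proof (cases "n = 0")
        case True
        then have "y = 0" using xy x(2) by simp
        have "v = 0"
        proof (rule ccontr)
          assume "v \<noteq> 0"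
          then have "\<beta> = (to_ac v * \<beta>) / to_ac v" by simp
          also have "to_ac v * \<beta> = - to_ac u"
            using \<open>y = 0\<close> by (simp add: y_def eq_neg_iff_add_eq_0 add.commute)
          finally have "\<beta> = to_ac (- u / v)" by simp
          moreover have "\<alpha> = to_ac a - \<beta>" using sum by (simp add: eq_diff_eq)
          ultimately have "\<alpha> = to_ac (a + u / v)" by simp
          with \<alpha> show False by blast
        qed
        with \<open>y = 0\<close> x(2) show ?thesis by (simp add: y_def uv)
      next
        case False
        have "y = to_ac (u + v * a) + to_ac (- v) * \<alpha>" by (simp add: y_def \<beta> algebra_simps)
        then have "y \<in> ?E" using memE by metis
        moreover have "inverse x = to_ac (inverse n) * y"
          using False xy by (intro inverse_unique) (simp add: mult.left_commute[of x])
        ultimately show ?thesis using mult[OF base] by metis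
      qed
    qed
  qed
  show "?E \<subseteq> field_gen {Pt \<alpha>, Pt \<beta>}"
  proof
    let ?S = "base_field \<union> {\<gamma>. Pt \<gamma> \<in> {Pt \<alpha>, Pt \<beta>}}"
    fix x assume "x \<in> ?E"
    then obtain u v where uv: "x = to_ac u + to_ac v * \<alpha>" by auto
    have "to_ac u \<oplus>\<^bsub>closure_ring\<^esub> (to_ac v \<otimes>\<^bsub>closure_ring\<^esub> \<alpha>) \<in> generate_field closure_ring ?S"
      by (intro generate_field.intros(2,5,6)) auto
    then show "x \<in> field_gen {Pt \<alpha>, Pt \<beta>}"
      by (simp add: field_gen_def uv ring_of_type_algebra_def)
  qed
qed

lemma quadratic_ext_degree:
  fixes \<alpha> :: "'a::field alg_closure"
  assumes "\<alpha> \<notin> base_field"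
  shows "has_ext_degree (range (\<lambda>(u, v). to_ac u + to_ac v * \<alpha>)) 2"
proof -
  interpret cring "closure_ring :: 'a alg_closure ring" by (rule cring_from_type_algebra)
  have line: "line_extension base_field x E = {to_ac k * x + v | k v. v \<in> E}"
    for x :: "'a alg_closure" and E
    by (auto simp: line_extension_mem_iff) (auto simp: ring_of_type_algebra_def)
  have "dimension 0 base_field {0 :: 'a alg_closure}"
    using zero_dim[of base_field] by (simp add: ring_of_type_algebra_def)
  then have "dimension (Suc 0) base_field (line_extension base_field 1 {0 :: 'a alg_closure})"
    by (intro Suc_dim) (auto simp: ring_of_type_algebra_def)
  also have "line_extension base_field 1 {0 :: 'a alg_closure} = base_field"
    by (auto simp: line)
  finally have "dimension (Suc (Suc 0)) base_field (line_extension base_field \<alpha> base_field)"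
    using assms by (intro Suc_dim) (auto simp: ring_of_type_algebra_def)
  also have "line_extension base_field \<alpha> base_field = range (\<lambda>(u, v). to_ac u + to_ac v * \<alpha>)"
  proof (intro equalityI subsetI)
    fix x assume "x \<in> line_extension base_field \<alpha> base_field"
    then obtain k c where "x = to_ac k * \<alpha> + to_ac c" by (auto simp: line)
    then show "x \<in> range (\<lambda>(u, v). to_ac u + to_ac v * \<alpha>)"
      by (intro range_eqI[of _ _ "(c, k)"]) (simp add: add.commute)
  next
    fix x assume "x \<in> range (\<lambda>(u, v). to_ac u + to_ac v * \<alpha>)"
    then obtain u v where "x = to_ac v * \<alpha> + to_ac u" by (auto simp: add.commute)
    then show "x \<in> line_extension base_field \<alpha> base_field" unfolding line by blast
  qed
  finally show ?thesis by (simp add: has_ext_degree_def numeral_2_eq_2)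
qed

section \<open>Critical points of a bicritical map\<close>

text \<open>
  The hypothesis \<open>field_gen {\<gamma>\<^sub>1, \<gamma>\<^sub>2} \<noteq> base_field\<close> yields an irrational finite critical point; which
  of the two it is does not matter, as the argument is symmetric.
\<close>

theorem theorem3p1:
  fixes \<phi> :: "'a::field poly fract"
    and \<gamma>\<^sub>1 \<gamma>\<^sub>2 :: "'a alg_closure proj_line"
    and d ell :: nat
  assumes "CHAR('a) = ell"
    and "bicritical \<phi>"
    and "critical_points \<phi> = {\<gamma>\<^sub>1, \<gamma>\<^sub>2}"
    and "rat_degree \<phi> = d"
    and "d \<ge> 2"
    and "ell = 0 \<or> ell > d"
    and "field_gen {\<gamma>\<^sub>1, \<gamma>\<^sub>2} \<noteq> (base_field :: 'a alg_closure set)"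
  shows "has_ext_degree (field_gen {\<gamma>\<^sub>1, \<gamma>\<^sub>2}) 2 \<and> galois_conjugate \<gamma>\<^sub>1 \<gamma>\<^sub>2"
proof -
  obtain w :: "'a poly" where w: "w \<noteq> 0"
    and ord: "\<And>\<alpha>. order \<alpha> (lift_poly w) = ram_index \<phi> (Pt \<alpha>) - 1"
    and bound: "\<And>\<alpha>. ram_index \<phi> (Pt \<alpha>) \<le> d"
    using ram_index_wronskian[of \<phi>] assms(1,4-6) by auto
  have crit: "Pt x \<in> {\<gamma>\<^sub>1, \<gamma>\<^sub>2} \<longleftrightarrow> poly (lift_poly w) x = 0" for x
    using w ord[of x] order_root[of "lift_poly w" x]
    by (auto simp: lift_poly_eq_0_iff critical_points_def simp flip: assms(3))
  have main: "has_ext_degree (field_gen {Pt \<alpha>, \<delta>}) 2 \<and>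
      galois_conjugate (Pt \<alpha>) \<delta> \<and> galois_conjugate \<delta> (Pt \<alpha>)"
    if \<alpha>: "\<alpha> \<notin> base_field" and pts: "{\<gamma>\<^sub>1, \<gamma>\<^sub>2} = {Pt \<alpha>, \<delta>}" for \<alpha> \<delta>
  proof -
    \<comment> \<open>At infinity \<open>\<beta>\<close> defaults to \<open>\<alpha>\<close>, a case that \<open>quadratic_factor\<close> then refutes.\<close>
    define \<beta> where "\<beta> = (case \<delta> of Pt x \<Rightarrow> x | Infty \<Rightarrow> \<alpha>)"
    have "x = \<alpha> \<or> x = \<beta>" if "poly (lift_poly w) x = 0" for x
      using that unfolding crit[symmetric] pts by (auto simp: \<beta>_def)
    moreover have root: "poly (lift_poly w) \<alpha> = 0" using crit[of \<alpha>] pts by simp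
    moreover have "CHAR('a) = 0 \<or> order \<alpha> (lift_poly w) < CHAR('a)"
      using ord[of \<alpha>] bound[of \<alpha>] assms(1,5,6) by auto
    ultimately obtain f a b where f: "irreducible f" "poly (lift_poly f) \<alpha> = 0" "poly (lift_poly f) \<beta> = 0"
      and neq: "\<alpha> \<noteq> \<beta>" and ab: "\<alpha> + \<beta> = to_ac a" "\<alpha> * \<beta> = to_ac b"
      using quadratic_factor[OF w _ _ _ \<alpha>] by blast
    have \<delta>: "\<delta> = Pt \<beta>" using neq by (cases \<delta>) (auto simp: \<beta>_def)
    have "galois_conjugate (Pt \<alpha>) \<delta>" "galois_conjugate \<delta> (Pt \<alpha>)"
      using galois_transitive_on_roots[OF f] galois_transitive_on_roots[OF f(1,3,2)]
      by (auto simp: galois_conjugate_def \<delta>)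
    with quadratic_ext_degree[OF \<alpha>] field_gen_quadratic[OF \<alpha> ab] show ?thesis by (simp add: \<delta>)
  qed
  obtain \<alpha> where "Pt \<alpha> \<in> {\<gamma>\<^sub>1, \<gamma>\<^sub>2}" "\<alpha> \<notin> base_field"
    using assms(7) field_gen_of_rational_points by blast
  then consider "\<gamma>\<^sub>1 = Pt \<alpha>" | "\<gamma>\<^sub>2 = Pt \<alpha>" by blast
  then show ?thesis
  proof cases
    case 1
    then show ?thesis using main[OF \<open>\<alpha> \<notin> base_field\<close>, of \<gamma>\<^sub>2] by simp
  next
    case 2
    have swap: "{\<gamma>\<^sub>1, \<gamma>\<^sub>2} = {Pt \<alpha>, \<gamma>\<^sub>1}" using 2 by blast
    show ?thesis using main[OF \<open>\<alpha> \<notin> base_field\<close> swap] unfolding swap unfolding 2 by blast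
  qed
qed

end
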